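(* There is a constant $d_0$ such that any (probabilistic bounded error or deterministic) symbolic algorithm that computes the strongly connected components of directed graphs with $n$ vertices and diameter at most $d_0$ needs $\Omega(n)$ symbolic one-step operations. That is, the $\Omega(n)$ lower bound for computing strongly connected components holds even for graphs of constant diameter.
   Context: Symbolic model: the input is a finite directed graph $G=(V,E)$ (self-loops allowed), $n=|V|$. The algorithm knows $V$, but it can access $E$ only through the one-step operations $\mathrm{Pre}(S)=\{v\in V\mid \exists s\in S:(v,s)\in E\}$ and $\mathrm{Post}(S)=\{v\in V\mid \exists s\in S:(s,v)\in E\}$ applied to (adaptively chosen) sets $S\subseteq V$. All other computation, in particular basic set operations such as $\cup,\cap,\setminus,\subseteq,=$ on vertex sets, is unrestricted and not counted in lower bounds; any number of sets may be stored. A probabilistic bounded error algorithm may use random bits and must be correct with probability at least $2/3$ on every (admissible) input. Convention for lower bounds: "needs $\Omega(n)$ one-step operations" on a class of inputs means: there is an absolute constant $c>0$ such that every (deterministic or probabilistic bounded error) symbolic algorithm that is correct on all inputs of the class performs, on inputs of the class with arbitrarily large $n$, at least $c\cdot n$ one-step operations (worst case over its random choices). The diameter of $G$ is the largest finite distance: the maximum of $d(u,v)$ over all pairs $u,v$ such that $u$ can reach $v$, where $d(u,v)$ is the smallest number of edges on a path from $u$ to $v$. *)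

theory Defs
  imports "HOL-Probability.Probability" "Graph_Theory.Graph_Theory"
begin

section \<open>Directed graphs\<close>

text \<open>
  Inputs are finite digraphs with self-loops but without parallel arcs
  (\<open>pair_fin_digraph\<close>); strongly connected components are the library's
  \<open>pre_digraph.sccs_verts\<close>.
\<close>

definition digraph_dist :: "'a pair_pre_digraph \<Rightarrow> 'a \<Rightarrow> 'a \<Rightarrow> nat" where
  "digraph_dist G u v =
     (LEAST k. \<exists>p. pre_digraph.awalk (with_proj G) u p v \<and> length p = k)"

text \<open>
  The supremum of a finite nonempty set of naturals is its maximum; the
  graph without vertices gets diameter 0.
\<close>

definition digraph_diameter :: "'a pair_pre_digraph \<Rightarrow> nat" where
  "digraph_diameter G = Sup {digraph_dist G u v | u v. u \<rightarrow>\<^sup>*\<^bsub>with_proj G\<^esub> v}"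

definition digraphs_diam_le :: "nat \<Rightarrow> nat pair_pre_digraph set" where
  "digraphs_diam_le d = {G. pair_fin_digraph G \<and> digraph_diameter G \<le> d}"

definition pre_set :: "'a pair_pre_digraph \<Rightarrow> 'a set \<Rightarrow> 'a set" where
  "pre_set G S = {v \<in> pverts G. \<exists>s\<in>S. (v, s) \<in> parcs G}"

definition post_set :: "'a pair_pre_digraph \<Rightarrow> 'a set \<Rightarrow> 'a set" where
  "post_set G S = {v \<in> pverts G. \<exists>s\<in>S. (s, v) \<in> parcs G}"


section \<open>Symbolic algorithms\<close>

text \<open>
  An algorithm sees the vertex set and chooses its next action as an arbitrary
  function of everything observed so far; this makes all computation other than
  the one-step operations free. Its earlier queries can be recomputed from
  the observations and so are not recorded. A run need not terminate.
\<close>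

datatype action = Toss | PreOp "nat set" | PostOp "nat set" | Halt "nat set set"

datatype observation = Coin bool | Answer "nat set"

type_synonym algorithm = "nat set \<Rightarrow> observation list \<Rightarrow> action"

text \<open>
  The run on \<open>G\<close> with random bits \<open>\<omega>\<close>, where a toss in step \<open>t\<close> reads bit \<open>\<omega> t\<close>
  (the bits at all other steps are ignored). After \<open>Halt\<close> the history no longer changes.
\<close>

primrec history ::
    "algorithm \<Rightarrow> nat pair_pre_digraph \<Rightarrow> (nat \<Rightarrow> bool) \<Rightarrow> nat \<Rightarrow> observation list" where
  "history A G \<omega> 0 = []"
| "history A G \<omega> (Suc t) =
     (let h = history A G \<omega> t in
      case A (pverts G) h of
        Toss \<Rightarrow> h @ [Coin (\<omega> t)]
      | PreOp S \<Rightarrow> h @ [Answer (pre_set G S)]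
      | PostOp S \<Rightarrow> h @ [Answer (post_set G S)]
      | Halt R \<Rightarrow> h)"

definition action_at ::
    "algorithm \<Rightarrow> nat pair_pre_digraph \<Rightarrow> (nat \<Rightarrow> bool) \<Rightarrow> nat \<Rightarrow> action" where
  "action_at A G \<omega> t = A (pverts G) (history A G \<omega> t)"

definition outputs ::
    "algorithm \<Rightarrow> nat pair_pre_digraph \<Rightarrow> (nat \<Rightarrow> bool) \<Rightarrow> nat set set \<Rightarrow> bool" where
  "outputs A G \<omega> R \<longleftrightarrow> (\<exists>t. action_at A G \<omega> t = Halt R)"

definition one_step_ops ::
    "algorithm \<Rightarrow> nat pair_pre_digraph \<Rightarrow> (nat \<Rightarrow> bool) \<Rightarrow> nat \<Rightarrow> nat" where
  "one_step_ops A G \<omega> t =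
     card {s. s < t \<and> (\<exists>S. action_at A G \<omega> s = PreOp S \<or> action_at A G \<omega> s = PostOp S)}"

definition worst_case_ops :: "algorithm \<Rightarrow> nat pair_pre_digraph \<Rightarrow> enat" where
  "worst_case_ops A G = (SUP \<omega>. SUP t. enat (one_step_ops A G \<omega> t))"


section \<open>Correctness\<close>

definition coins :: "(nat \<Rightarrow> bool) measure" where
  "coins = (\<Pi>\<^sub>M t\<in>UNIV. measure_pmf (bernoulli_pmf (1/2)))"

definition deterministic :: "algorithm \<Rightarrow> bool" where
  "deterministic A \<longleftrightarrow> (\<forall>V h. A V h \<noteq> Toss)"

definition computes_sccs_always :: "algorithm \<Rightarrow> nat pair_pre_digraph set \<Rightarrow> bool" where
  "computes_sccs_always A C \<longleftrightarrow>
     (\<forall>G\<in>C. \<forall>\<omega>. outputs A G \<omega> (pre_digraph.sccs_verts (with_proj G)))"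

definition computes_sccs_bounded_error :: "algorithm \<Rightarrow> nat pair_pre_digraph set \<Rightarrow> bool" where
  "computes_sccs_bounded_error A C \<longleftrightarrow>
     (\<forall>G\<in>C. measure coins {\<omega>. outputs A G \<omega> (pre_digraph.sccs_verts (with_proj G))} \<ge> 2/3)"

text \<open>
  The event in \<open>computes_sccs_bounded_error\<close> is measurable for every algorithm, so
  its measure is a genuine probability.
\<close>

lemma prob_space_coins: "prob_space coins"
  unfolding coins_def by (intro prob_space_PiM measure_pmf.prob_space_axioms)

lemma space_coins: "space coins = UNIV"
  by (simp add: coins_def space_PiM)

lemma measurable_history: "(\<lambda>\<omega>. history A G \<omega> t) \<in> measurable coins (count_space UNIV)"
proof (induction t)
  case 0
  show ?case by simp
next
  case (Suc t)
  define g where "g b h =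
     (case A (pverts G) h of
        Toss \<Rightarrow> h @ [Coin b]
      | PreOp S \<Rightarrow> h @ [Answer (pre_set G S)]
      | PostOp S \<Rightarrow> h @ [Answer (post_set G S)]
      | Halt R \<Rightarrow> h)" for b h
  have eq: "history A G \<omega> (Suc t) =
      (if \<omega> t then g True (history A G \<omega> t) else g False (history A G \<omega> t))" for \<omega>
    by (auto simp: g_def Let_def split: action.split)
  have coin: "(\<lambda>\<omega>. \<omega> t) \<in> measurable coins (count_space UNIV)"
    unfolding coins_def
    using measurable_component_singleton
      [of t UNIV "\<lambda>_. measure_pmf (bernoulli_pmf (1/2))"] by simp
  have g: "(\<lambda>\<omega>. g b (history A G \<omega> t)) \<in> measurable coins (count_space UNIV)" for b
    by (rule measurable_compose[OF Suc.IH]) simp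
  show ?case
    unfolding eq using coin g by (intro measurable_If) (auto simp: pred_def)
qed

lemma sets_outputs: "{\<omega>. outputs A G \<omega> R} \<in> sets coins"
proof -
  have "{\<omega>. outputs A G \<omega> R} =
      (\<Union>t. (\<lambda>\<omega>. history A G \<omega> t) -` {h. A (pverts G) h = Halt R} \<inter> space coins)"
    by (auto simp: outputs_def action_at_def space_coins)
  also have "\<dots> \<in> sets coins"
    by (intro sets.countable_UN'' measurable_sets[OF measurable_history]) auto
  finally show ?thesis .
qed

end

(*
  On the vertices 0, ..., 2m - 1 take all arcs (u, v) with u \<le> v and, for a set I of even
  numbers, the arcs (v + 1, v) with v \<in> I. The arc relation is its own reflexive transitive
  closure, so the diameter is at most 1, and the 2^m choices of I give 2^m different
  partitions into components. The arcs u \<le> v hide the backward arcs: Post(S) depends on I only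
  through the single arc leaving Min S backwards, and Pre(S) only through the one entering
  Max S, so every operation has just two possible answers. For fixed random bits, the runs
  with at most q operations therefore produce at most 2^q different outputs, while a bounded
  error algorithm produces 2/3 * 2^m of the partitions on average.
*)
theory Submission
  imports Defs
begin

section \<open>Counting the outputs of an algorithm\<close>

text \<open>The candidates \<open>a\<close> and \<open>b\<close> may depend on the query but not on
  the graph, so an operation reveals at most one bit about which member of the family is the
  input.\<close>

definition binary_answers :: "nat pair_pre_digraph set \<Rightarrow> bool" where
  "binary_answers \<G> \<longleftrightarrow>
     (\<forall>S. \<exists>a b. \<forall>G\<in>\<G>. pre_set G S \<in> {a, b}) \<and>
     (\<forall>S. \<exists>a b. \<forall>G\<in>\<G>. post_set G S \<in> {a, b})"

primrec is_answer :: "observation \<Rightarrow> bool" where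
  "is_answer (Coin b) \<longleftrightarrow> False"
| "is_answer (Answer S) \<longleftrightarrow> True"

text \<open>Tosses are left out: with the random bits fixed, a toss does not distinguish one input
  from another.\<close>

definition answer_count :: "observation list \<Rightarrow> nat" where
  "answer_count h = length (filter is_answer h)"

text \<open>Each operation appends exactly one answer, so the number of operations becomes a
  function of the history and can serve as its depth in a code tree.\<close>

lemma one_step_ops_eq_answer_count:
  "one_step_ops A G \<omega> t = answer_count (history A G \<omega> t)"
proof (induction t)
  case 0
  show ?case by (simp add: one_step_ops_def answer_count_def)
next
  case (Suc t)
  define P where "P s \<longleftrightarrow> (\<exists>S. action_at A G \<omega> s = PreOp S \<or> action_at A G \<omega> s = PostOp S)" for s
  have "{s. s < Suc t \<and> P s} = (if P t then insert t {s. s < t \<and> P s} else {s. s < t \<and> P s})"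
    by (auto simp: less_Suc_eq)
  then have "one_step_ops A G \<omega> (Suc t) = one_step_ops A G \<omega> t + (if P t then 1 else 0)"
    by (simp add: one_step_ops_def P_def[symmetric])
  then show ?case
    using Suc.IH by (auto simp: P_def action_at_def answer_count_def Let_def split: action.splits)
qed

lemma history_after_Halt:
  assumes "action_at A G \<omega> t = Halt R"
  shows "history A G \<omega> (t + k) = history A G \<omega> t"
  using assms by (induction k) (simp_all add: action_at_def)

section \<open>A Kraft inequality for runs with fixed random bits\<close>

lemma sum_UN_le:
  fixes f :: "'a \<Rightarrow> real"
  assumes "finite I" "\<And>i. i \<in> I \<Longrightarrow> finite (B i)" "\<And>x. 0 \<le> f x"
  shows "sum f (\<Union>i\<in>I. B i) \<le> (\<Sum>i\<in>I. sum f (B i))"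
  using assms(1,2)
proof (induction I rule: finite_induct)
  case empty
  show ?case by simp
next
  case (insert i I)
  have "sum f (B i \<union> (\<Union>i\<in>I. B i)) + sum f (B i \<inter> (\<Union>i\<in>I. B i)) =
      sum f (B i) + sum f (\<Union>i\<in>I. B i)"
    using insert by (intro sum.union_inter) auto
  moreover have "0 \<le> sum f (B i \<inter> (\<Union>i\<in>I. B i))"
    by (intro sum_nonneg assms(3))
  ultimately show ?case
    using insert by auto
qed

text \<open>The possible histories form a tree that branches, at most in two, only at operations.
  Giving a history the weight 2^-k for k answers, no step increases the total weight. Weights
  instead of a plain count accommodate runs with different numbers of operations at the same time
  \<open>t\<close>.\<close>

lemma kraft_inequality_histories:
  assumes "finite \<G>" and verts: "\<And>G. G \<in> \<G> \<Longrightarrow> pverts G = V" and binary: "binary_answers \<G>"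
  shows "(\<Sum>h \<in> (\<lambda>G. history A G \<omega> t) ` \<G>. (1/2) ^ answer_count h) \<le> (1::real)"
proof (induction t)
  case 0
  have "(\<lambda>G. history A G \<omega> 0) ` \<G> \<subseteq> {[]}" by auto
  then have "(\<Sum>h \<in> (\<lambda>G. history A G \<omega> 0) ` \<G>. (1/2) ^ answer_count h)
      \<le> (\<Sum>h \<in> {[]}. (1/2::real) ^ answer_count h)"
    by (intro sum_mono2) auto
  then show ?case by (simp add: answer_count_def)
next
  case (Suc t)
  let ?H = "\<lambda>t. (\<lambda>G. history A G \<omega> t) ` \<G>"
  let ?w = "\<lambda>h. (1/2::real) ^ answer_count h"
  from binary have "\<forall>S. \<exists>a b. \<forall>G\<in>\<G>. pre_set G S \<in> {a, b}"
    unfolding binary_answers_def by (rule conjunct1)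
  then obtain a b where pre: "\<And>S G. G \<in> \<G> \<Longrightarrow> pre_set G S \<in> {a S, b S}"
    unfolding choice_iff by blast
  from binary have "\<forall>S. \<exists>a b. \<forall>G\<in>\<G>. post_set G S \<in> {a, b}"
    unfolding binary_answers_def by (rule conjunct2)
  then obtain a' b' where post: "\<And>S G. G \<in> \<G> \<Longrightarrow> post_set G S \<in> {a' S, b' S}"
    unfolding choice_iff by blast
  \<comment> \<open>Both candidate answers are included, so this set depends on the history alone
    and not on the graph.\<close>
  define children where "children h =
    (case A V h of
       Toss \<Rightarrow> {h @ [Coin (\<omega> t)]}
     | PreOp S \<Rightarrow> {h @ [Answer (a S)], h @ [Answer (b S)]}
     | PostOp S \<Rightarrow> {h @ [Answer (a' S)], h @ [Answer (b' S)]}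
     | Halt R \<Rightarrow> {h})" for h
  have fin: "finite (children h)" for h
    by (simp add: children_def split: action.split)
  \<comment> \<open>Only an inequality, since the two candidate answers may coincide.\<close>
  have two: "sum ?w {x, y} \<le> ?w x + ?w y" for x y
    by (cases "x = y") auto
  have half: "?w (h @ [Answer X]) + ?w (h @ [Answer Y]) = ?w h" for h X Y
    by (simp add: answer_count_def)
  have le: "sum ?w (children h) \<le> ?w h" for h
  proof (cases "A V h")
    case (PreOp S)
    then show ?thesis
      using two[of "h @ [Answer (a S)]" "h @ [Answer (b S)]"] unfolding half
      by (simp only: children_def action.case)
  next
    case (PostOp S)
    then show ?thesis
      using two[of "h @ [Answer (a' S)]" "h @ [Answer (b' S)]"] unfolding half
      by (simp only: children_def action.case)
  next
    case Toss
    then show ?thesis by (simp add: children_def answer_count_def)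
  next
    case (Halt R)
    then show ?thesis by (simp add: children_def)
  qed
  have "?H (Suc t) \<subseteq> (\<Union>h \<in> ?H t. children h)"
  proof clarify
    fix G assume "G \<in> \<G>"
    then have "history A G \<omega> (Suc t) \<in> children (history A G \<omega> t)"
      \<comment> \<open>The common vertex set \<open>V\<close> makes the next action
        \<open>A V h\<close> the same for all graphs with history \<open>h\<close>.\<close>
      using verts[of G] pre[of G] post[of G]
      by (auto simp: children_def Let_def split: action.splits)
    then show "history A G \<omega> (Suc t) \<in> (\<Union>h \<in> ?H t. children h)"
      using \<open>G \<in> \<G>\<close> by blast
  qed
  then have "sum ?w (?H (Suc t)) \<le> sum ?w (\<Union>h \<in> ?H t. children h)"
    using \<open>finite \<G>\<close> fin by (intro sum_mono2) auto
  \<comment> \<open>Subadditivity avoids proving that the child sets of different histories are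
    disjoint.\<close>
  also have "\<dots> \<le> (\<Sum>h \<in> ?H t. sum ?w (children h))"
    using \<open>finite \<G>\<close> fin by (intro sum_UN_le) auto
  also have "\<dots> \<le> sum ?w (?H t)"
    by (intro sum_mono le)
  also have "\<dots> \<le> 1" by (fact Suc.IH)
  finally show ?case .
qed

text \<open>A final history determines the output, and \<open>F\<close> is injective, so correct
  runs on different graphs end in different histories. Each of these weighs at least 2^-q, and the
  Kraft inequality leaves room for at most 2^q of them.\<close>

lemma card_correct_outputs_le:
  assumes "finite \<G>" and "\<And>G. G \<in> \<G> \<Longrightarrow> pverts G = V" and "binary_answers \<G>"
    and inj: "inj_on F \<G>"
    and ops: "\<And>G t. G \<in> \<G> \<Longrightarrow> one_step_ops A G \<omega> t \<le> q"
  shows "card {G \<in> \<G>. outputs A G \<omega> (F G)} \<le> 2 ^ q"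
proof -
  define C where "C = {G \<in> \<G>. outputs A G \<omega> (F G)}"
  have "C \<subseteq> \<G>" and "finite C" using \<open>finite \<G>\<close> by (auto simp: C_def)
  have "\<forall>G\<in>C. \<exists>t. action_at A G \<omega> t = Halt (F G)"
    by (simp add: C_def outputs_def)
  from bchoice[OF this] obtain halt where
    halt: "\<And>G. G \<in> C \<Longrightarrow> action_at A G \<omega> (halt G) = Halt (F G)"
    by blast
  \<comment> \<open>A common time by which all correct runs have halted; the inserted 0 covers empty
    \<open>C\<close>.\<close>
  define T where "T = Max (insert 0 (halt ` C))"
  have T: "action_at A G \<omega> T = Halt (F G)" if "G \<in> C" for G
  proof -
    have "halt G \<le> T" using that \<open>finite C\<close> by (simp add: T_def)
    then have "history A G \<omega> T = history A G \<omega> (halt G)"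
      using history_after_Halt[OF halt[OF that], of "T - halt G"] by simp
    then show ?thesis using halt[OF that] by (simp add: action_at_def)
  qed
  have "inj_on (\<lambda>G. history A G \<omega> T) C"
  proof (rule inj_onI)
    fix G G' assume *: "G \<in> C" "G' \<in> C" "history A G \<omega> T = history A G' \<omega> T"
    then have "pverts G = pverts G'" using assms(2) \<open>C \<subseteq> \<G>\<close> by (metis subsetD)
    then have "F G = F G'"
      using * T[of G] T[of G'] by (simp add: action_at_def)
    then show "G = G'" using inj * \<open>C \<subseteq> \<G>\<close> by (auto dest: inj_onD)
  qed
  then have "real (card C) * (1/2) ^ q = (\<Sum>h \<in> (\<lambda>G. history A G \<omega> T) ` C. (1/2) ^ q)"
    by (simp add: card_image)
  also have "\<dots> \<le> (\<Sum>h \<in> (\<lambda>G. history A G \<omega> T) ` C. (1/2) ^ answer_count h)"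
    using ops \<open>C \<subseteq> \<G>\<close>
    by (intro sum_mono power_decreasing) (auto simp: one_step_ops_eq_answer_count)
  also have "\<dots> \<le> (\<Sum>h \<in> (\<lambda>G. history A G \<omega> T) ` \<G>. (1/2) ^ answer_count h)"
    using \<open>finite \<G>\<close> \<open>C \<subseteq> \<G>\<close> by (intro sum_mono2) auto
  also have "\<dots> \<le> 1"
    using assms(1-3) by (rule kraft_inequality_histories)
  finally have "real (card C) \<le> 2 ^ q"
    by (simp add: power_one_over field_simps)
  then show ?thesis
    unfolding C_def[symmetric] by (metis of_nat_le_iff of_nat_numeral of_nat_power)
qed

text \<open>Averaging over a uniform input, as in Yao's principle: the expected number of graphs
  answered correctly is the sum of the success probabilities, and for each \<open>\<omega>\<close>
  that number is at most 2^q.\<close>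

lemma bounded_error_card_le:
  assumes "finite \<G>" and "\<And>G. G \<in> \<G> \<Longrightarrow> pverts G = V" and "binary_answers \<G>"
    and "inj_on (\<lambda>G. pre_digraph.sccs_verts (with_proj G)) \<G>"
    and "\<And>G \<omega> t. G \<in> \<G> \<Longrightarrow> one_step_ops A G \<omega> t \<le> q"
    and err: "computes_sccs_bounded_error A \<G>"
  shows "2/3 * real (card \<G>) \<le> 2 ^ q"
proof -
  interpret prob_space coins by (rule prob_space_coins)
  let ?F = "\<lambda>G. pre_digraph.sccs_verts (with_proj G)"
  let ?E = "\<lambda>G. {\<omega>. outputs A G \<omega> (?F G)}"
  have int: "integrable coins (indicator (?E G) :: _ \<Rightarrow> real)" for G
    using sets_outputs[of A G "?F G"] by (simp add: integrable_real_indicator emeasure_eq_measure)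
  have pointwise: "(\<Sum>G\<in>\<G>. indicator (?E G) \<omega>) \<le> (2 ^ q :: real)" for \<omega>
  proof -
    have "(\<Sum>G\<in>\<G>. indicator (?E G) \<omega>) = real (card {G \<in> \<G>. outputs A G \<omega> (?F G)})"
      using \<open>finite \<G>\<close> by (simp add: indicator_def sum.If_cases Int_def)
    also have "\<dots> \<le> real (2 ^ q)"
      using assms(1-5) by (intro of_nat_mono card_correct_outputs_le)
    finally show ?thesis by simp
  qed
  have "2/3 * real (card \<G>) = (\<Sum>G\<in>\<G>. 2/3)" by simp
  also have "\<dots> \<le> (\<Sum>G\<in>\<G>. measure coins (?E G))"
    using err by (intro sum_mono) (simp add: computes_sccs_bounded_error_def)
  also have "\<dots> = (\<Sum>G\<in>\<G>. \<integral>\<omega>. indicator (?E G) \<omega> \<partial>coins)"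
    by (simp add: space_coins)
  also have "\<dots> = (\<integral>\<omega>. (\<Sum>G\<in>\<G>. indicator (?E G) \<omega>) \<partial>coins)"
    using int by (simp add: Bochner_Integration.integral_sum)
  also have "\<dots> \<le> 2 ^ q"
    using int pointwise by (intro integral_le_const) auto
  finally show ?thesis .
qed

lemma computes_sccs_always_imp_bounded_error:
  assumes "computes_sccs_always A C"
  shows "computes_sccs_bounded_error A C"
proof -
  interpret prob_space coins by (rule prob_space_coins)
  have "{\<omega>. outputs A G \<omega> (pre_digraph.sccs_verts (with_proj G))} = space coins" if "G \<in> C" for G
    using assms that by (auto simp: computes_sccs_always_def space_coins)
  then show ?thesis
    by (simp add: computes_sccs_bounded_error_def prob_space)
qed


section \<open>The hard instances\<close>

text \<open>The lower endpoints of the m disjoint pairs {2i, 2i + 1}. A backward arc merges one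
  pair, and parity keeps backward arcs from chaining.\<close>

definition evens :: "nat \<Rightarrow> nat set" where
  "evens m = (\<lambda>i. 2 * i) ` {..<m}"

definition hard_graph :: "nat \<Rightarrow> nat set \<Rightarrow> nat pair_pre_digraph" where
  "hard_graph m I = \<lparr>pverts = {..<2 * m},
     parcs = {(u, v). u < 2 * m \<and> v < 2 * m \<and> (u \<le> v \<or> u = Suc v \<and> v \<in> I)}\<rparr>"

lemma finite_evens [simp]: "finite (evens m)"
  and card_evens [simp]: "card (evens m) = m"
  by (simp_all add: evens_def card_image inj_on_def)

lemma evensD: "v \<in> evens m \<Longrightarrow> even v \<and> Suc v < 2 * m"
  by (auto simp: evens_def)

lemma pverts_hard_graph [simp]: "pverts (hard_graph m I) = {..<2 * m}"
  by (simp add: hard_graph_def)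

lemma parcs_hard_graph:
  "(u, v) \<in> parcs (hard_graph m I) \<longleftrightarrow>
     u < 2 * m \<and> v < 2 * m \<and> (u \<le> v \<or> u = Suc v \<and> v \<in> I)"
  by (simp add: hard_graph_def)

lemma pair_fin_digraph_hard_graph: "pair_fin_digraph (hard_graph m I)"
proof
  have "parcs (hard_graph m I) \<subseteq> {..<2 * m} \<times> {..<2 * m}"
    by (auto simp: hard_graph_def)
  then show "finite (parcs (hard_graph m I))"
    by (rule finite_subset) simp
qed (auto simp: hard_graph_def)

text \<open>The arc relation is transitive: a forward and a backward arc compose to an arc because
  the backward one moves by a single step, and two consecutive backward arcs would need adjacent
  numbers in \<open>I\<close>.\<close>

lemma reachable_hard_graph_iff:
  assumes "I \<subseteq> evens m"
  shows "u \<rightarrow>\<^sup>*\<^bsub>with_proj (hard_graph m I)\<^esub> v \<longleftrightarrow> (u, v) \<in> parcs (hard_graph m I)"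
proof -
  interpret pair_fin_digraph "hard_graph m I" by (rule pair_fin_digraph_hard_graph)
  have I: "even v" if "v \<in> I" for v using that assms evensD by blast
  show ?thesis
  proof
    assume "u \<rightarrow>\<^sup>*\<^bsub>with_proj (hard_graph m I)\<^esub> v"
    then show "(u, v) \<in> parcs (hard_graph m I)"
    proof (induction rule: reachable_induct)
      case base
      then show ?case by (simp add: parcs_hard_graph)
    next
      case (step x y)
      then show ?case
        using I[of x] I[of y] by (cases "x = y") (auto simp: parcs_hard_graph)
    qed
  qed (use reachable_adjI in auto)
qed

lemma hard_graph_in_diam_1:
  assumes "I \<subseteq> evens m" and "0 < m"
  shows "hard_graph m I \<in> digraphs_diam_le 1"
proof -
  let ?G = "hard_graph m I"
  let ?D = "{digraph_dist ?G u v | u v. u \<rightarrow>\<^sup>*\<^bsub>with_proj ?G\<^esub> v}"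
  interpret pair_fin_digraph ?G by (rule pair_fin_digraph_hard_graph)
  have "digraph_dist ?G u v \<le> 1" if "u \<rightarrow>\<^sup>*\<^bsub>with_proj ?G\<^esub> v" for u v
  proof -
    from that have "(u, v) \<in> parcs ?G" using assms by (simp add: reachable_hard_graph_iff)
    then have "awalk u [(u, v)] v"
      by (auto simp: awalk_def parcs_hard_graph)
    then show ?thesis
      unfolding digraph_dist_def by (intro Least_le) (rule exI[of _ "[(u, v)]"], simp)
  qed
  \<comment> \<open>The loop at 0 supplies a distance, as \<open>cSup_least\<close> needs a nonempty
    set.\<close>
  moreover have "(0, 0) \<in> parcs ?G" using assms by (simp add: parcs_hard_graph)
  then have "?D \<noteq> {}" using assms by (auto simp: reachable_hard_graph_iff)
  ultimately have "digraph_diameter ?G \<le> 1"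
    unfolding digraph_diameter_def by (intro cSup_least) auto
  then show ?thesis
    by (simp add: digraphs_diam_le_def pair_fin_digraph_hard_graph)
qed

lemma binary_answers_hard_graph: "binary_answers (hard_graph m ` \<I>)"
proof -
  have "\<exists>a b. \<forall>I\<in>\<I>. pre_set (hard_graph m I) S \<in> {a, b}" for S
  proof (cases "S \<inter> {..<2 * m} = {}")
    case True
    then have "pre_set (hard_graph m I) S = {}" for I
      by (auto simp: pre_set_def parcs_hard_graph)
    then show ?thesis by (intro exI[of _ "{}"]) simp
  next
    case False
    define k where "k = Max (S \<inter> {..<2 * m})"
    have k: "k \<in> S" "k < 2 * m" "\<And>s. s \<in> S \<Longrightarrow> s < 2 * m \<Longrightarrow> s \<le> k"
      using False Max_in[of "S \<inter> {..<2 * m}"] by (auto simp: k_def)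
    \<comment> \<open>A backward arc into some s < k starts at \<open>Suc s\<close>, at most k,
      which is below k already; only k itself can add a vertex, namely \<open>Suc k\<close>. As
      \<open>I\<close> is arbitrary here, \<open>Suc k\<close> may lie outside the graph.\<close>
    have "pre_set (hard_graph m I) S =
        (if k \<in> I \<and> Suc k < 2 * m then {..Suc k} else {..k})" for I
    proof (rule set_eqI)
      fix v
      have "v \<in> pre_set (hard_graph m I) S \<longleftrightarrow>
          v < 2 * m \<and> (\<exists>s\<in>S. s < 2 * m \<and> (v \<le> s \<or> v = Suc s \<and> s \<in> I))"
        by (auto simp: pre_set_def parcs_hard_graph)
      also have "\<dots> \<longleftrightarrow> v \<le> k \<or> v = Suc k \<and> k \<in> I \<and> Suc k < 2 * m"
      proof (intro iffI; (elim conjE bexE)?)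
        fix s assume s: "v < 2 * m" "s \<in> S" "s < 2 * m" "v \<le> s \<or> v = Suc s \<and> s \<in> I"
        with k(3)[of s] show "v \<le> k \<or> v = Suc k \<and> k \<in> I \<and> Suc k < 2 * m"
          by (cases "s = k") auto
      next
        assume "v \<le> k \<or> v = Suc k \<and> k \<in> I \<and> Suc k < 2 * m"
        with k(1,2) show "v < 2 * m \<and> (\<exists>s\<in>S. s < 2 * m \<and> (v \<le> s \<or> v = Suc s \<and> s \<in> I))"
          by (intro conjI bexI[of _ k]) auto
      qed
      finally show "v \<in> pre_set (hard_graph m I) S \<longleftrightarrow>
          v \<in> (if k \<in> I \<and> Suc k < 2 * m then {..Suc k} else {..k})"
        by auto
    qed
    then show ?thesis by (intro exI[of _ "{..Suc k}"] exI[of _ "{..k}"]) simp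
  qed
  moreover have "\<exists>a b. \<forall>I\<in>\<I>. post_set (hard_graph m I) S \<in> {a, b}" for S
  proof (cases "S \<inter> {..<2 * m} = {}")
    case True
    then have "post_set (hard_graph m I) S = {}" for I
      by (auto simp: post_set_def parcs_hard_graph)
    then show ?thesis by (intro exI[of _ "{}"]) simp
  next
    case False
    define k where "k = Min (S \<inter> {..<2 * m})"
    have k: "k \<in> S" "k < 2 * m" "\<And>s. s \<in> S \<Longrightarrow> s < 2 * m \<Longrightarrow> k \<le> s"
      using False Min_in[of "S \<inter> {..<2 * m}"] by (auto simp: k_def)
    \<comment> \<open>Dually, a backward arc leaving some s > k ends at k or above. In the first
      branch \<open>k - 1\<close> is \<open>j\<close>, so the subtraction is not truncated.\<close>
    have "post_set (hard_graph m I) S =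
        (if \<exists>j\<in>I. k = Suc j then {k - 1..<2 * m} else {k..<2 * m})" for I
    proof (rule set_eqI)
      fix v
      have "v \<in> post_set (hard_graph m I) S \<longleftrightarrow>
          v < 2 * m \<and> (\<exists>s\<in>S. s < 2 * m \<and> (s \<le> v \<or> s = Suc v \<and> v \<in> I))"
        by (auto simp: post_set_def parcs_hard_graph)
      also have "\<dots> \<longleftrightarrow> v < 2 * m \<and> (k \<le> v \<or> k = Suc v \<and> v \<in> I)"
      proof (intro iffI; (elim conjE bexE)?)
        fix s assume s: "v < 2 * m" "s \<in> S" "s < 2 * m" "s \<le> v \<or> s = Suc v \<and> v \<in> I"
        with k(3)[of s] show "v < 2 * m \<and> (k \<le> v \<or> k = Suc v \<and> v \<in> I)"
          by (cases "s = k") auto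
      next
        assume "v < 2 * m" "k \<le> v \<or> k = Suc v \<and> v \<in> I"
        with k(1,2) show "v < 2 * m \<and> (\<exists>s\<in>S. s < 2 * m \<and> (s \<le> v \<or> s = Suc v \<and> v \<in> I))"
          by (intro conjI bexI[of _ k]) auto
      qed
      finally show "v \<in> post_set (hard_graph m I) S \<longleftrightarrow>
          v \<in> (if \<exists>j\<in>I. k = Suc j then {k - 1..<2 * m} else {k..<2 * m})"
        by (cases "k = Suc v") auto
    qed
    then show ?thesis by (intro exI[of _ "{k - 1..<2 * m}"] exI[of _ "{k..<2 * m}"]) simp
  qed
  ultimately show ?thesis
    by (simp add: binary_answers_def)
qed

text \<open>Decodes \<open>I\<close> from the partition. The pair of \<open>v\<close> in
  \<open>I\<close> is a whole component because extending it would need an odd element of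
  \<open>I\<close>; conversely, \<open>Suc v\<close> reaches \<open>v\<close> only through the
  backward arc.\<close>

lemma in_backward_arcs_iff:
  assumes "I \<subseteq> evens m"
  shows "v \<in> I \<longleftrightarrow> (\<exists>S \<in> pre_digraph.sccs_verts (with_proj (hard_graph m I)). v \<in> S \<and> Suc v \<in> S)"
proof
  assume "v \<in> I"
  then have v: "even v" "Suc v < 2 * m" using assms evensD by blast+
  have I: "even w" if "w \<in> I" for w using that assms evensD by blast
  have "{v, Suc v} \<in> pre_digraph.sccs_verts (with_proj (hard_graph m I))"
    unfolding pre_digraph.sccs_verts_def reachable_hard_graph_iff[OF assms] parcs_hard_graph
    using v \<open>v \<in> I\<close> by (auto dest: I)
  then show "\<exists>S \<in> pre_digraph.sccs_verts (with_proj (hard_graph m I)). v \<in> S \<and> Suc v \<in> S"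
    by blast
next
  assume "\<exists>S \<in> pre_digraph.sccs_verts (with_proj (hard_graph m I)). v \<in> S \<and> Suc v \<in> S"
  then have "(Suc v, v) \<in> parcs (hard_graph m I)"
    unfolding pre_digraph.sccs_verts_def reachable_hard_graph_iff[OF assms] by blast
  then show "v \<in> I" by (simp add: parcs_hard_graph)
qed

lemma hard_graph_eq_if_sccs_eq:
  assumes "I \<subseteq> evens m" "J \<subseteq> evens m"
    and "pre_digraph.sccs_verts (with_proj (hard_graph m I)) =
      pre_digraph.sccs_verts (with_proj (hard_graph m J))"
  shows "I = J"
  using in_backward_arcs_iff[OF assms(1)] in_backward_arcs_iff[OF assms(2)]
  unfolding assms(3) by blast

section \<open>The linear bound at diameter at most 1\<close>

theorem mainTheorem2:
  shows "\<exists>d\<^sub>0 :: nat. \<exists>c :: real. c > 0 \<and>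
    (\<forall>A :: algorithm.
       (deterministic A \<and> computes_sccs_always A (digraphs_diam_le d\<^sub>0)) \<or>
       computes_sccs_bounded_error A (digraphs_diam_le d\<^sub>0) \<longrightarrow>
       (\<forall>N :: nat. \<exists>G \<in> digraphs_diam_le d\<^sub>0. card (pverts G) \<ge> N \<and>
          ereal (c * real (card (pverts G))) \<le> ereal_of_enat (worst_case_ops A G)))"
\<comment> \<open>The factor 1/2 reflects one hidden bit for each pair of vertices.\<close>
proof (intro exI[of _ "1::nat"] exI[of _ "1/2::real"] conjI allI impI)
  fix A :: algorithm and N :: nat
  assume "(deterministic A \<and> computes_sccs_always A (digraphs_diam_le 1)) \<or>
       computes_sccs_bounded_error A (digraphs_diam_le 1)"
  then have err: "computes_sccs_bounded_error A (digraphs_diam_le 1)"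
    using computes_sccs_always_imp_bounded_error by blast
  \<comment> \<open>Makes m positive and 2m at least \<open>N\<close>; fewer than m operations then
    means at most \<open>N\<close>.\<close>
  define m where "m = Suc N"
  define \<G> where "\<G> = hard_graph m ` Pow (evens m)"
  have sub: "\<G> \<subseteq> digraphs_diam_le 1"
    using hard_graph_in_diam_1[of _ m] by (auto simp: \<G>_def m_def)
  have verts: "pverts G = {..<2 * m}" if "G \<in> \<G>" for G
    using that by (auto simp: \<G>_def)
  show "\<exists>G \<in> digraphs_diam_le 1. card (pverts G) \<ge> N \<and>
          ereal (1/2 * real (card (pverts G))) \<le> ereal_of_enat (worst_case_ops A G)"
  proof (rule ccontr)
    \<comment> \<open>The negation bounds the operations on all graphs of \<G> at once, giving the
      uniform bound \<open>N\<close> needed for counting.\<close>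
    assume contra: "\<not> ?thesis"
    have small: "\<not> ereal (real m) \<le> ereal_of_enat (worst_case_ops A G)" if "G \<in> \<G>" for G
    proof -
      have card: "card (pverts G) = 2 * m" using verts[OF that] by simp
      moreover have "N \<le> 2 * m" by (simp add: m_def)
      ultimately have "\<not> ereal (1/2 * real (2 * m)) \<le> ereal_of_enat (worst_case_ops A G)"
        using contra that sub by (metis subsetD)
      then show ?thesis by simp
    qed
    have ops: "one_step_ops A G \<omega> t \<le> N" if "G \<in> \<G>" for G \<omega> t
    proof -
      have "enat (one_step_ops A G \<omega> t) \<le> worst_case_ops A G"
        unfolding worst_case_ops_def by (meson SUP_upper UNIV_I order_trans)
      also have "worst_case_ops A G < enat m"
        using small[OF that] by (metis ereal_of_enat_le_iff ereal_of_enat_simps(1) not_le)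
      finally show ?thesis by (simp add: m_def)
    qed
    have inj: "inj_on (\<lambda>G. pre_digraph.sccs_verts (with_proj G)) \<G>"
      by (auto simp: \<G>_def intro!: inj_onI dest: hard_graph_eq_if_sccs_eq)
    \<comment> \<open>Equal graphs have equal components, so decoding also separates the
      graphs.\<close>
    have "inj_on (hard_graph m) (Pow (evens m))"
      by (intro inj_onI hard_graph_eq_if_sccs_eq) auto
    then have "card \<G> = 2 ^ m"
      by (simp add: \<G>_def card_image card_Pow)
    moreover have "2/3 * real (card \<G>) \<le> 2 ^ N"
    proof (rule bounded_error_card_le[OF _ verts _ inj ops])
      show "finite \<G>" by (simp add: \<G>_def)
      show "binary_answers \<G>" unfolding \<G>_def by (rule binary_answers_hard_graph)
      show "computes_sccs_bounded_error A \<G>"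
        using err sub by (auto simp: computes_sccs_bounded_error_def)
    qed
    \<comment> \<open>2/3 * 2^(N + 1) = 4/3 * 2^N exceeds 2^N.\<close>
    ultimately show False by (simp add: m_def)
  qed
qed simp

end
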